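(* Let $A$ be a bi-skew brace with gamma function $\gamma$. Then $A$ is a soluble skew brace if and only if $\gamma(A)=\{\gamma(a)\mid a\in A\}\subseteq \operatorname{Aut}(A,\cdot)$ is a soluble group.
   Context: A skew brace (meaning skew left brace) is a set $A$ with two group structures $(A,\cdot)$ (the additive group) and $(A,\circ)$ (the multiplicative group) such that $a\circ(b\cdot c)=(a\circ b)\cdot a^{-1}\cdot(a\circ c)$ for all $a,b,c\in A$, where $a^{-1}$ is the inverse of $a$ in $(A,\cdot)$. The two groups have the same neutral element, denoted $1$. A bi-skew brace is a skew brace $(A,\cdot,\circ)$ such that $(A,\circ,\cdot)$ is also a skew brace. The gamma function of a skew brace $(A,\cdot,\circ)$ is the group homomorphism $\gamma\colon(A,\circ)\to\operatorname{Aut}(A,\cdot)$ given by $\gamma(a)(b)=a^{-1}\cdot(a\circ b)$. For $a,b\in A$ put $a*b=a^{-1}\cdot(a\circ b)\cdot b^{-1}$. For subsets $X,Y\subseteq A$, $X*Y$ is the subgroup of $(A,\cdot)$ generated by $\{x*y\mid x\in X,\ y\in Y\}$. Set $A_1=A$ and $A_m=A_{m-1}*A_{m-1}$ for $m\ge 2$. The skew brace $A$ is soluble if $A_m=\{1\}$ for some $m\ge1$. *)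

theory Defs
  imports "HOL-Algebra.Algebra"
begin

text \<open>
  A skew brace \<open>(A, \<cdot>, \<circ>)\<close> is represented by two group structures \<open>G = (A, \<cdot>)\<close> and
  \<open>H = (A, \<circ>)\<close> with the same carrier. That the two neutral elements coincide is a
  consequence of the axioms (\<open>one_eq\<close> below) and is therefore not assumed.
\<close>

locale skew_brace = add: group G + mul: group H
  for G :: "('a, 'b) monoid_scheme" and H :: "('a, 'c) monoid_scheme" +
  assumes carrier_eq: "carrier H = carrier G"
    and compat: "\<lbrakk>a \<in> carrier G; b \<in> carrier G; c \<in> carrier G\<rbrakk> \<Longrightarrow>
      a \<otimes>\<^bsub>H\<^esub> (b \<otimes>\<^bsub>G\<^esub> c) = (a \<otimes>\<^bsub>H\<^esub> b) \<otimes>\<^bsub>G\<^esub> inv\<^bsub>G\<^esub> a \<otimes>\<^bsub>G\<^esub> (a \<otimes>\<^bsub>H\<^esub> c)"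

locale bi_skew_brace = skew_brace G H + swap: skew_brace H G
  for G :: "('a, 'b) monoid_scheme" and H :: "('a, 'c) monoid_scheme"

text \<open>Restricted to the carrier because \<^const>\<open>AutoGroup\<close> consists of extensional functions.\<close>

definition gamma :: "('a, 'b) monoid_scheme \<Rightarrow> ('a, 'c) monoid_scheme \<Rightarrow> 'a \<Rightarrow> 'a \<Rightarrow> 'a" where
  "gamma G H a = (\<lambda>b\<in>carrier G. inv\<^bsub>G\<^esub> a \<otimes>\<^bsub>G\<^esub> (a \<otimes>\<^bsub>H\<^esub> b))"

definition gamma_group ::
    "('a, 'b) monoid_scheme \<Rightarrow> ('a, 'c) monoid_scheme \<Rightarrow> ('a \<Rightarrow> 'a) monoid" where
  "gamma_group G H = (AutoGroup G)\<lparr>carrier := gamma G H ` carrier G\<rparr>"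

definition star :: "('a, 'b) monoid_scheme \<Rightarrow> ('a, 'c) monoid_scheme \<Rightarrow> 'a \<Rightarrow> 'a \<Rightarrow> 'a" where
  "star G H a b = inv\<^bsub>G\<^esub> a \<otimes>\<^bsub>G\<^esub> (a \<otimes>\<^bsub>H\<^esub> b) \<otimes>\<^bsub>G\<^esub> inv\<^bsub>G\<^esub> b"

definition star_set ::
    "('a, 'b) monoid_scheme \<Rightarrow> ('a, 'c) monoid_scheme \<Rightarrow> 'a set \<Rightarrow> 'a set \<Rightarrow> 'a set" where
  "star_set G H S T = generate G {star G H x y | x y. x \<in> S \<and> y \<in> T}"

text \<open>The series \<open>A\<^sub>m\<close> is indexed from 1; the value at index 0 is a dummy.\<close>

fun brace_series ::
    "('a, 'b) monoid_scheme \<Rightarrow> ('a, 'c) monoid_scheme \<Rightarrow> nat \<Rightarrow> 'a set" where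
  "brace_series G H 0 = carrier G"
| "brace_series G H (Suc 0) = carrier G"
| "brace_series G H (Suc (Suc m)) =
     star_set G H (brace_series G H (Suc m)) (brace_series G H (Suc m))"

definition soluble_brace :: "('a, 'b) monoid_scheme \<Rightarrow> ('a, 'c) monoid_scheme \<Rightarrow> bool" where
  "soluble_brace G H \<longleftrightarrow> (\<exists>m\<ge>1. brace_series G H m = {\<one>\<^bsub>G\<^esub>})"

context skew_brace
begin

lemma mul_closed [simp]:
  "\<lbrakk>a \<in> carrier G; b \<in> carrier G\<rbrakk> \<Longrightarrow> a \<otimes>\<^bsub>H\<^esub> b \<in> carrier G"
  using mul.m_closed carrier_eq by simp

lemma one_eq: "\<one>\<^bsub>H\<^esub> = \<one>\<^bsub>G\<^esub>"
proof -
  have o: "\<one>\<^bsub>H\<^esub> \<in> carrier G" using mul.one_closed carrier_eq by simp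
  have "\<one>\<^bsub>H\<^esub> \<otimes>\<^bsub>H\<^esub> (\<one>\<^bsub>G\<^esub> \<otimes>\<^bsub>G\<^esub> \<one>\<^bsub>G\<^esub>) =
      (\<one>\<^bsub>H\<^esub> \<otimes>\<^bsub>H\<^esub> \<one>\<^bsub>G\<^esub>) \<otimes>\<^bsub>G\<^esub> inv\<^bsub>G\<^esub> \<one>\<^bsub>H\<^esub> \<otimes>\<^bsub>G\<^esub> (\<one>\<^bsub>H\<^esub> \<otimes>\<^bsub>H\<^esub> \<one>\<^bsub>G\<^esub>)"
    using compat o by blast
  hence "inv\<^bsub>G\<^esub> \<one>\<^bsub>H\<^esub> = \<one>\<^bsub>G\<^esub>" using o carrier_eq by simp
  thus ?thesis using o by (metis add.inv_inv add.inv_one)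
qed

lemma gamma_mult:
  assumes "a \<in> carrier G" "b \<in> carrier G"
  shows "gamma G H (a \<otimes>\<^bsub>H\<^esub> b) = compose (carrier G) (gamma G H a) (gamma G H b)"
proof
  fix x
  show "gamma G H (a \<otimes>\<^bsub>H\<^esub> b) x = compose (carrier G) (gamma G H a) (gamma G H b) x"
  proof (cases "x \<in> carrier G")
    case True
    have e: "a \<otimes>\<^bsub>H\<^esub> (b \<otimes>\<^bsub>G\<^esub> y) = (a \<otimes>\<^bsub>H\<^esub> b) \<otimes>\<^bsub>G\<^esub> (inv\<^bsub>G\<^esub> a \<otimes>\<^bsub>G\<^esub> (a \<otimes>\<^bsub>H\<^esub> y))"
      if "y \<in> carrier G" for y
      using compat[OF assms that] assms that by (simp add: add.m_assoc)
    define y where "y = inv\<^bsub>G\<^esub> b \<otimes>\<^bsub>G\<^esub> (b \<otimes>\<^bsub>H\<^esub> x)"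
    have y: "y \<in> carrier G" using assms True by (simp add: y_def)
    have "b \<otimes>\<^bsub>G\<^esub> y = b \<otimes>\<^bsub>H\<^esub> x"
      using assms True by (simp add: y_def add.m_assoc [symmetric])
    hence "a \<otimes>\<^bsub>H\<^esub> b \<otimes>\<^bsub>H\<^esub> x = (a \<otimes>\<^bsub>H\<^esub> b) \<otimes>\<^bsub>G\<^esub> (inv\<^bsub>G\<^esub> a \<otimes>\<^bsub>G\<^esub> (a \<otimes>\<^bsub>H\<^esub> y))"
      using e[OF y] mul.m_assoc assms True carrier_eq by simp
    hence "inv\<^bsub>G\<^esub> (a \<otimes>\<^bsub>H\<^esub> b) \<otimes>\<^bsub>G\<^esub> (a \<otimes>\<^bsub>H\<^esub> b \<otimes>\<^bsub>H\<^esub> x) = inv\<^bsub>G\<^esub> a \<otimes>\<^bsub>G\<^esub> (a \<otimes>\<^bsub>H\<^esub> y)"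
      using assms y by (simp add: add.m_assoc [symmetric])
    thus ?thesis using True y assms by (simp add: gamma_def compose_def y_def)
  qed (simp add: gamma_def compose_def)
qed

lemma gamma_one: "gamma G H \<one>\<^bsub>H\<^esub> = (\<lambda>x\<in>carrier G. x)"
  unfolding gamma_def by (rule restrict_ext) (metis add.inv_one add.l_one carrier_eq mul.l_one one_eq)

lemma gamma_closed: "\<lbrakk>a \<in> carrier G; b \<in> carrier G\<rbrakk> \<Longrightarrow> gamma G H a b \<in> carrier G"
  by (simp add: gamma_def)

lemma gamma_in_auto:
  assumes a: "a \<in> carrier G"
  shows "gamma G H a \<in> auto G"
proof -
  have i: "inv\<^bsub>H\<^esub> a \<in> carrier G" using a carrier_eq mul.inv_closed by simp
  have l: "compose (carrier G) (gamma G H (inv\<^bsub>H\<^esub> a)) (gamma G H a) = (\<lambda>x\<in>carrier G. x)"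
    using gamma_mult[OF i a] gamma_one a carrier_eq mul.l_inv by simp
  have r: "compose (carrier G) (gamma G H a) (gamma G H (inv\<^bsub>H\<^esub> a)) = (\<lambda>x\<in>carrier G. x)"
    using gamma_mult[OF a i] gamma_one a carrier_eq mul.r_inv by simp
  have "bij_betw (gamma G H a) (carrier G) (carrier G)"
  proof (rule bij_betw_byWitness[where f' = "gamma G H (inv\<^bsub>H\<^esub> a)"])
    show "\<forall>x\<in>carrier G. gamma G H (inv\<^bsub>H\<^esub> a) (gamma G H a x) = x"
      using fun_cong[OF l] by (metis compose_eq restrict_apply')
    show "\<forall>x\<in>carrier G. gamma G H a (gamma G H (inv\<^bsub>H\<^esub> a) x) = x"
      using fun_cong[OF r] by (metis compose_eq restrict_apply')
  qed (use a i gamma_closed in auto)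
  moreover have "gamma G H a \<in> hom G G"
  proof (rule homI)
    fix x y assume "x \<in> carrier G" "y \<in> carrier G"
    thus "gamma G H a (x \<otimes>\<^bsub>G\<^esub> y) = gamma G H a x \<otimes>\<^bsub>G\<^esub> gamma G H a y"
      using a by (simp add: gamma_def compat add.m_assoc)
  qed (use a gamma_closed in auto)
  ultimately show ?thesis by (simp add: auto_def Bij_def gamma_def)
qed

lemma gamma_hom: "gamma G H \<in> hom H (AutoGroup G)"
proof (rule homI)
  fix a b assume "a \<in> carrier H" "b \<in> carrier H"
  hence ab: "a \<in> carrier G" "b \<in> carrier G" by (simp_all add: carrier_eq)
  have "gamma G H a \<in> Bij (carrier G)" "gamma G H b \<in> Bij (carrier G)"
    using gamma_in_auto[OF ab(1)] gamma_in_auto[OF ab(2)] by (simp_all add: auto_def)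
  thus "gamma G H (a \<otimes>\<^bsub>H\<^esub> b) = gamma G H a \<otimes>\<^bsub>AutoGroup G\<^esub> gamma G H b"
    using gamma_mult[OF ab] by (simp add: AutoGroup_def BijGroup_def)
qed (simp add: AutoGroup_def gamma_in_auto carrier_eq)

lemma gamma_image_subgroup: "subgroup (gamma G H ` carrier G) (AutoGroup G)"
proof -
  interpret group_hom H "AutoGroup G" "gamma G H"
    by (intro group_hom.intro group_hom_axioms.intro mul.is_group add.AutoGroup gamma_hom)
  show ?thesis using img_is_subgroup by (simp add: carrier_eq)
qed

lemma gamma_group_is_group: "group (gamma_group G H)"
  unfolding gamma_group_def
  by (rule subgroup.subgroup_is_group[OF gamma_image_subgroup add.AutoGroup])

end

end

theory Submission
  imports Defs
begin

text \<open>
  Write \<open>K = \<gamma>(A)\<close>. The map \<open>\<gamma>\<close> is a homomorphism on \<open>(A, \<circ>)\<close>; the second compatibility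
  axiom makes it an anti-homomorphism on \<open>(A, \<cdot>)\<close> as well, because \<open>a \<mapsto> \<gamma>(a)\<^sup>-\<^sup>1\<close> is precisely
  the gamma function of the swapped skew brace \<open>(A, \<circ>, \<cdot>)\<close>
  (\<open>gamma_swap_eq_inv_gamma\<close>). Comparing the two rules on
  \<open>a \<circ> b = a \<cdot> \<gamma>(a)(b)\<close> gives \<open>\<gamma>(\<gamma>(a)(b)) = \<gamma>(a) \<gamma>(b) \<gamma>(a)\<^sup>-\<^sup>1\<close>, and since
  \<open>a * b = \<gamma>(a)(b) \<cdot> b\<^sup>-\<^sup>1\<close>, the inverse of \<open>\<gamma>(a * b)\<close> is the commutator of \<open>\<gamma>(a)\<close> and
  \<open>\<gamma>(b)\<^sup>-\<^sup>1\<close> (\<open>gamma_swap_star\<close>). Hence \<open>\<gamma>\<close> carries the series \<open>A\<^sub>m\<close> onto the derived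
  series of \<open>K\<close> (\<open>gamma_image_brace_series\<close>).

  One implication is then immediate. For the other, \<open>\<gamma>(A\<^sub>m) = 1\<close> says that every element of
  \<open>A\<^sub>m\<close> acts trivially, so that all \<open>a * b = \<gamma>(a)(b) \<cdot> b\<^sup>-\<^sup>1\<close> with \<open>a \<in> A\<^sub>m\<close> vanish and
  \<open>A\<^sub>m\<^sub>+\<^sub>1 = {1}\<close>: the series of \<open>A\<close> ends at most one step after the derived series of \<open>K\<close>.
\<close>

context skew_brace
begin

lemma gamma_group_hom: "group_hom H (gamma_group G H) (gamma G H)"
proof (intro group_hom.intro group_hom_axioms.intro mul.is_group gamma_group_is_group homI)
  fix a b assume "a \<in> carrier H" "b \<in> carrier H"
  thus "gamma G H (a \<otimes>\<^bsub>H\<^esub> b) = gamma G H a \<otimes>\<^bsub>gamma_group G H\<^esub> gamma G H b"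
    using hom_mult[OF gamma_hom] by (simp add: gamma_group_def)
qed (simp add: gamma_group_def carrier_eq)

lemma star_eq_gamma:
  assumes "b \<in> carrier G"
  shows "star G H a b = gamma G H a b \<otimes>\<^bsub>G\<^esub> inv\<^bsub>G\<^esub> b"
  using assms by (simp add: star_def gamma_def)

lemma star_closed:
  assumes "a \<in> carrier G" "b \<in> carrier G"
  shows "star G H a b \<in> carrier G"
  using assms by (simp add: star_eq_gamma gamma_closed)

text \<open>
  Compatibility, applied to \<open>a\<^sup>\<circ> \<circ> (a \<cdot> b)\<close> with \<open>a\<^sup>\<circ>\<close> the inverse of \<open>a\<close> in \<open>(A, \<circ>)\<close>, rewrites
  the gamma function of the swapped operations in terms of the original one.
\<close>

lemma gamma_swap_eq_inv_gamma:
  assumes a: "a \<in> carrier G"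
  shows "gamma H G a = inv\<^bsub>gamma_group G H\<^esub> (gamma G H a)"
proof -
  interpret gam: group_hom H "gamma_group G H" "gamma G H" by (rule gamma_group_hom)
  have i: "inv\<^bsub>H\<^esub> a \<in> carrier G" using a carrier_eq mul.inv_closed by simp
  have "gamma H G a = gamma G H (inv\<^bsub>H\<^esub> a)"
    unfolding gamma_def carrier_eq
  proof (rule restrict_ext)
    fix b assume b: "b \<in> carrier G"
    have "inv\<^bsub>H\<^esub> a \<otimes>\<^bsub>H\<^esub> a = \<one>\<^bsub>G\<^esub>" using a carrier_eq one_eq by simp
    thus "inv\<^bsub>H\<^esub> a \<otimes>\<^bsub>H\<^esub> (a \<otimes>\<^bsub>G\<^esub> b) = inv\<^bsub>G\<^esub> (inv\<^bsub>H\<^esub> a) \<otimes>\<^bsub>G\<^esub> (inv\<^bsub>H\<^esub> a \<otimes>\<^bsub>H\<^esub> b)"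
      using compat[OF i a b] a b i by simp
  qed
  thus ?thesis using a carrier_eq by simp
qed

lemma gamma_eq_one_iff:
  "gamma G H a = \<one>\<^bsub>gamma_group G H\<^esub> \<longleftrightarrow> (\<forall>b\<in>carrier G. gamma G H a b = b)"
proof -
  have "\<one>\<^bsub>gamma_group G H\<^esub> = (\<lambda>b\<in>carrier G. b)"
    by (simp add: gamma_group_def AutoGroup_def BijGroup_def)
  thus ?thesis by (auto simp: gamma_def fun_eq_iff)
qed

lemma brace_series_subgroup: "subgroup (brace_series G H m) G"
proof (induction m rule: induct_nat_012)
  case (ge2 m)
  show ?case
    unfolding brace_series.simps star_set_def
    by (rule add.generate_is_subgroup)
       (use subgroup.subset[OF ge2(2)] star_closed in blast)
qed (simp_all add: add.subgroup_self)

lemma brace_series_trivial_of_gamma_trivial: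
  assumes "m \<ge> 1" "gamma G H ` brace_series G H m = {\<one>\<^bsub>gamma_group G H\<^esub>}"
  shows "brace_series G H (Suc m) = {\<one>\<^bsub>G\<^esub>}"
proof -
  let ?S = "brace_series G H m"
  let ?X = "{star G H x y | x y. x \<in> ?S \<and> y \<in> ?S}"
  have "?X \<subseteq> {\<one>\<^bsub>G\<^esub>}"
  proof safe
    fix x y assume x: "x \<in> ?S" and y: "y \<in> ?S"
    have yG: "y \<in> carrier G" using y subgroup.subset[OF brace_series_subgroup] by blast
    have "gamma G H x y = y" using assms(2) x yG gamma_eq_one_iff by blast
    thus "star G H x y = \<one>\<^bsub>G\<^esub>" using yG by (simp add: star_eq_gamma)
  qed
  hence "generate G ?X \<subseteq> {\<one>\<^bsub>G\<^esub>}"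
    by (rule add.generate_subgroup_incl) (rule add.triv_subgroup)
  hence "generate G ?X = {\<one>\<^bsub>G\<^esub>}" using generate.one by blast
  thus ?thesis using assms(1) by (cases m) (auto simp: star_set_def)
qed

end

context bi_skew_brace
begin

text \<open>
  The swapped gamma function \<open>a \<mapsto> \<gamma>(a)\<^sup>-\<^sup>1\<close> is a homomorphism on the additive group, so it
  transports the subgroups of \<open>(A, \<cdot>)\<close> generated in the definition of \<open>A\<^sub>m\<close>; the
  anti-homomorphism \<open>\<gamma>\<close> itself cannot be used with \<open>group_hom\<close> there.
\<close>

lemma gamma_swap_group_hom: "group_hom G (gamma_group G H) (gamma H G)"
proof (intro group_hom.intro group_hom_axioms.intro add.is_group gamma_group_is_group homI)
  interpret gam: group_hom H "gamma_group G H" "gamma G H" by (rule gamma_group_hom)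
  show "gamma H G a \<in> carrier (gamma_group G H)" if "a \<in> carrier G" for a
    using that gamma_swap_eq_inv_gamma carrier_eq by simp
  fix a b assume ab: "a \<in> carrier G" "b \<in> carrier G"
  have "gamma H G x \<in> Bij (carrier G)" if "x \<in> carrier G" for x
    using swap.gamma_in_auto[of x] that by (simp add: auto_def carrier_eq)
  thus "gamma H G (a \<otimes>\<^bsub>G\<^esub> b) = gamma H G a \<otimes>\<^bsub>gamma_group G H\<^esub> gamma H G b"
    using swap.gamma_mult[of a b] ab
    by (simp add: carrier_eq gamma_group_def AutoGroup_def BijGroup_def)
qed

lemma gamma_add:
  assumes "a \<in> carrier G" "b \<in> carrier G"
  shows "gamma G H (a \<otimes>\<^bsub>G\<^esub> b) = gamma G H b \<otimes>\<^bsub>gamma_group G H\<^esub> gamma G H a"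
proof -
  interpret gam: group_hom H "gamma_group G H" "gamma G H" by (rule gamma_group_hom)
  interpret del: group_hom G "gamma_group G H" "gamma H G" by (rule gamma_swap_group_hom)
  have [simp]: "gamma G H x \<in> carrier (gamma_group G H)" if "x \<in> carrier G" for x
    using that carrier_eq gam.hom_closed by simp
  have "inv\<^bsub>gamma_group G H\<^esub> gamma G H (a \<otimes>\<^bsub>G\<^esub> b) =
      inv\<^bsub>gamma_group G H\<^esub> (gamma G H b \<otimes>\<^bsub>gamma_group G H\<^esub> gamma G H a)"
    using del.hom_mult[OF assms] assms
    by (simp add: gamma_swap_eq_inv_gamma gam.H.inv_mult_group)
  thus ?thesis using assms by (metis add.m_closed carrier_eq gam.H.inv_inv gam.H.m_closed gam.hom_closed)
qed

text \<open>
  Both product rules for \<open>\<gamma>\<close>, evaluated on \<open>a \<circ> b = a \<cdot> \<gamma>(a)(b)\<close>, give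
  \<open>\<gamma>(a) \<gamma>(b) = \<gamma>(\<gamma>(a)(b)) \<gamma>(a)\<close>.
\<close>

lemma gamma_gamma_eq_conjugate:
  assumes a: "a \<in> carrier G" and b: "b \<in> carrier G"
  shows "gamma G H (gamma G H a b) = gamma G H a \<otimes>\<^bsub>gamma_group G H\<^esub> gamma G H b
    \<otimes>\<^bsub>gamma_group G H\<^esub> inv\<^bsub>gamma_group G H\<^esub> (gamma G H a)"
proof -
  interpret gam: group_hom H "gamma_group G H" "gamma G H" by (rule gamma_group_hom)
  have c [simp]: "gamma G H x \<in> carrier (gamma_group G H)" if "x \<in> carrier G" for x
    using that carrier_eq gam.hom_closed by simp
  have g: "gamma G H a b \<in> carrier G" using a b by (rule gamma_closed)
  have "a \<otimes>\<^bsub>G\<^esub> gamma G H a b = a \<otimes>\<^bsub>H\<^esub> b"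
    using a b by (simp add: gamma_def add.m_assoc [symmetric])
  hence "gamma G H (gamma G H a b) \<otimes>\<^bsub>gamma_group G H\<^esub> gamma G H a =
      gamma G H a \<otimes>\<^bsub>gamma_group G H\<^esub> gamma G H b"
    using gamma_add[OF a g] gam.hom_mult[of a b] a b carrier_eq by simp
  thus ?thesis using a b g by (metis c gam.H.inv_solve_right gam.H.m_closed)
qed

text \<open>
  Up to passing to inverses, \<open>\<gamma>\<close> turns the star operation into a commutator. The right-hand
  side has the shape that \<^const>\<open>derived\<close> uses for commutators, with second argument
  \<open>\<gamma>(b)\<^sup>-\<^sup>1\<close>.
\<close>

lemma gamma_swap_star:
  assumes a: "a \<in> carrier G" and b: "b \<in> carrier G"
  shows "gamma H G (star G H a b) = gamma G H a \<otimes>\<^bsub>gamma_group G H\<^esub> gamma H G b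
    \<otimes>\<^bsub>gamma_group G H\<^esub> inv\<^bsub>gamma_group G H\<^esub> (gamma G H a)
    \<otimes>\<^bsub>gamma_group G H\<^esub> inv\<^bsub>gamma_group G H\<^esub> (gamma H G b)"
proof -
  interpret gam: group_hom H "gamma_group G H" "gamma G H" by (rule gamma_group_hom)
  interpret del: group_hom G "gamma_group G H" "gamma H G" by (rule gamma_swap_group_hom)
  have [simp]: "gamma G H x \<in> carrier (gamma_group G H)" if "x \<in> carrier G" for x
    using that carrier_eq gam.hom_closed by simp
  have g: "gamma G H a b \<in> carrier G" using a b by (rule gamma_closed)
  have "gamma H G (star G H a b) =
      gamma H G (gamma G H a b) \<otimes>\<^bsub>gamma_group G H\<^esub> inv\<^bsub>gamma_group G H\<^esub> (gamma H G b)"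
    using b g by (simp add: star_eq_gamma)
  thus ?thesis
    using a b g gamma_gamma_eq_conjugate[OF a b]
    by (simp add: gamma_swap_eq_inv_gamma gam.H.inv_mult_group gam.H.m_assoc)
qed

text \<open>
  A subgroup is closed under inverses, so \<open>\<gamma>\<close> and \<open>a \<mapsto> \<gamma>(a)\<^sup>-\<^sup>1\<close> have the same image on it.
\<close>

lemma gamma_swap_image_subgroup:
  assumes S: "subgroup S G"
  shows "gamma H G ` S = gamma G H ` S"
proof -
  interpret gam: group_hom H "gamma_group G H" "gamma G H" by (rule gamma_group_hom)
  interpret del: group_hom G "gamma_group G H" "gamma H G" by (rule gamma_swap_group_hom)
  have c: "x \<in> carrier G" if "x \<in> S" for x using that subgroup.mem_carrier[OF S] by blast
  have i: "inv\<^bsub>G\<^esub> x \<in> S" if "x \<in> S" for x using that subgroup.m_inv_closed[OF S] by blast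
  have e: "gamma H G (inv\<^bsub>G\<^esub> x) = gamma G H x" if "x \<in> S" for x
    using del.hom_inv[OF c[OF that]] gamma_swap_eq_inv_gamma[OF c[OF that]]
      gam.hom_closed[of x] c[OF that] carrier_eq gam.H.inv_inv by metis
  have "gamma H G x \<in> gamma G H ` S" if "x \<in> S" for x
    using e[OF i[OF that]] i[OF that] c[OF that] by (metis add.inv_inv image_eqI)
  moreover have "gamma G H x \<in> gamma H G ` S" if "x \<in> S" for x
    using e[OF that] i[OF that] by (metis image_eqI)
  ultimately show ?thesis by blast
qed

text \<open>
  The commutators in \<open>gamma_swap_star\<close> have their first argument in the image of \<open>S\<close> under
  \<open>\<gamma>\<close> and their second in the image under \<open>a \<mapsto> \<gamma>(a)\<^sup>-\<^sup>1\<close>; as these images agree,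
  all commutators of \<open>\<gamma>(S)\<close> occur.
\<close>

lemma gamma_image_star_set:
  assumes S: "subgroup S G"
  shows "gamma G H ` star_set G H S S = derived (gamma_group G H) (gamma G H ` S)"
proof -
  interpret del: group_hom G "gamma_group G H" "gamma H G" by (rule gamma_swap_group_hom)
  let ?K = "gamma_group G H"
  let ?X = "{star G H x y | x y. x \<in> S \<and> y \<in> S}"
  have c: "x \<in> carrier G" if "x \<in> S" for x using that subgroup.mem_carrier[OF S] by blast
  have X: "?X \<subseteq> carrier G" using star_closed c by blast
  have "gamma H G ` ?X = {gamma H G (star G H x y) | x y. x \<in> S \<and> y \<in> S}" by blast
  also have "\<dots> = {gamma G H x \<otimes>\<^bsub>?K\<^esub> gamma H G y \<otimes>\<^bsub>?K\<^esub> inv\<^bsub>?K\<^esub> (gamma G H x)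
      \<otimes>\<^bsub>?K\<^esub> inv\<^bsub>?K\<^esub> (gamma H G y) | x y. x \<in> S \<and> y \<in> S}"
    using gamma_swap_star c by (metis (no_types, lifting))
  also have "\<dots> = (\<Union>h\<in>gamma G H ` S. \<Union>k\<in>gamma H G ` S.
      {h \<otimes>\<^bsub>?K\<^esub> k \<otimes>\<^bsub>?K\<^esub> inv\<^bsub>?K\<^esub> h \<otimes>\<^bsub>?K\<^esub> inv\<^bsub>?K\<^esub> k})"
    by blast
  also have "\<dots> = derived_set ?K (gamma G H ` S)"
    unfolding gamma_swap_image_subgroup[OF S] ..
  finally have "derived ?K (gamma G H ` S) = gamma H G ` generate G ?X"
    using del.generate_img[OF X] by (simp add: derived_def)
  thus ?thesis
    using gamma_swap_image_subgroup[OF add.generate_is_subgroup[OF X]]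
    by (simp add: star_set_def)
qed

lemma gamma_image_brace_series:
  "gamma G H ` brace_series G H (Suc n) =
    (derived (gamma_group G H) ^^ n) (carrier (gamma_group G H))"
proof (induction n)
  case 0
  show ?case by (simp add: gamma_group_def)
next
  case (Suc n)
  thus ?case using gamma_image_star_set[OF brace_series_subgroup[of "Suc n"]] by simp
qed

end

theorem proposition3p9:
  fixes G :: "('a, 'b) monoid_scheme" and H :: "('a, 'c) monoid_scheme"
  assumes "bi_skew_brace G H"
  shows "soluble_brace G H \<longleftrightarrow> solvable (gamma_group G H)"
proof -
  interpret bi_skew_brace G H by fact
  interpret gam: group_hom H "gamma_group G H" "gamma G H" by (rule gamma_group_hom)
  have "soluble_brace G H \<longleftrightarrow>
      (\<exists>n. gamma G H ` brace_series G H (Suc n) = {\<one>\<^bsub>gamma_group G H\<^esub>})"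
  proof
    assume "soluble_brace G H"
    then obtain n where "brace_series G H (Suc n) = {\<one>\<^bsub>G\<^esub>}"
      unfolding soluble_brace_def by (metis Suc_le_D One_nat_def)
    moreover have "gamma G H \<one>\<^bsub>G\<^esub> = \<one>\<^bsub>gamma_group G H\<^esub>"
      using gam.hom_one by (simp add: one_eq)
    ultimately show "\<exists>n. gamma G H ` brace_series G H (Suc n) = {\<one>\<^bsub>gamma_group G H\<^esub>}"
      by (metis image_empty image_insert)
  next
    assume "\<exists>n. gamma G H ` brace_series G H (Suc n) = {\<one>\<^bsub>gamma_group G H\<^esub>}"
    then obtain n where "gamma G H ` brace_series G H (Suc n) = {\<one>\<^bsub>gamma_group G H\<^esub>}" ..
    hence "brace_series G H (Suc (Suc n)) = {\<one>\<^bsub>G\<^esub>}"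
      by (intro brace_series_trivial_of_gamma_trivial) simp
    thus "soluble_brace G H"
      unfolding soluble_brace_def by (metis One_nat_def Suc_le_mono le0)
  qed
  thus ?thesis
    by (simp only: gamma_image_brace_series gam.H.solvable_iff_trivial_derived_seq)
qed

end
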